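(* Let $(K,v)$ be a valued field with valuation ring $\mathcal{O}$, and let $|\cdot|$ be an absolute value on $K$ corresponding to a valuation coarsening $v$, such that $\mathcal{O}$ is complete for the metric $|x-y|$; let $D(x,y) = \inf_{z\in\mathcal{O}}|y - xz|$. Consider the imaginary $v\mathcal{O}$: the set of values $v(x)$, $x\in\mathcal{O}$ (i.e. $\mathcal{O}$ modulo multiplication by units), with the order of the value set and the metric $d(v(x),v(y)) = \max(D(x,y),D(y,x))$. Then $v\mathcal{O}$ is a metric linear order, and for all $x,y\in\mathcal{O}$, $r(v(x),v(y)) = D(x,y)$, so this metric linear order structure is interpretable. In particular, $v\mathcal{O}\models \mathsf{ULO}$.
   Context: A metric linear order is a set with a linear order $\le$ and a metric $d$ such that every open ball is order-convex; its ray predicate is $r(a,b)=\inf_{c\le b}d(a,c)$, the distance from $a$ to $(-\infty,b]$. $\mathsf{ULO}$ is the theory of (complete, diameter $\le1$) metric linear orders whose metric is an ultrametric. The structures in the statement are exactly the models of the theory $\mathsf{MVR}$ of metric valuation rings in the language $\{0,1,+,-,\cdot,D\}$ with metric $|x-y|$. *)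

theory Defs
  imports "HOL-Analysis.Analysis"
begin

section \<open>Valued fields\<close>

text \<open>A value group \<open>\<Gamma>\<close>, written additively, together with a top element \<open>\<infinity>\<close>.\<close>

datatype 'g val_ext = Val 'g | Infty

instantiation val_ext :: (linorder) linorder
begin

definition less_eq_val_ext :: "'a val_ext \<Rightarrow> 'a val_ext \<Rightarrow> bool" where
  "a \<le> b \<longleftrightarrow>
     (case b of Infty \<Rightarrow> True | Val h \<Rightarrow> (case a of Infty \<Rightarrow> False | Val g \<Rightarrow> g \<le> h))"

definition less_val_ext :: "'a val_ext \<Rightarrow> 'a val_ext \<Rightarrow> bool" where
  "a < b \<longleftrightarrow>
     (case a of Infty \<Rightarrow> False | Val g \<Rightarrow> (case b of Infty \<Rightarrow> True | Val h \<Rightarrow> g < h))"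

instance
  by standard (auto simp: less_eq_val_ext_def less_val_ext_def split: val_ext.splits)

end

instantiation val_ext :: (plus) plus
begin

definition plus_val_ext :: "'a val_ext \<Rightarrow> 'a val_ext \<Rightarrow> 'a val_ext" where
  "a + b = (case a of Infty \<Rightarrow> Infty
            | Val g \<Rightarrow> (case b of Infty \<Rightarrow> Infty | Val h \<Rightarrow> Val (g + h)))"

instance ..

end

definition valuation :: "('k::field \<Rightarrow> 'g::linordered_ab_group_add val_ext) \<Rightarrow> bool" where
  "valuation v \<longleftrightarrow>
     (\<forall>x. v x = Infty \<longleftrightarrow> x = 0) \<and>
     (\<forall>x y. v (x * y) = v x + v y) \<and>
     (\<forall>x y. min (v x) (v y) \<le> v (x + y))"

definition valuation_ring :: "('k::field \<Rightarrow> 'g::linordered_ab_group_add val_ext) \<Rightarrow> 'k set" where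
  "valuation_ring v = {x. Val 0 \<le> v x}"

definition coarsens ::
  "('k::field \<Rightarrow> 'h::linordered_ab_group_add val_ext) \<Rightarrow>
   ('k \<Rightarrow> 'g::linordered_ab_group_add val_ext) \<Rightarrow> bool" where
  "coarsens w v \<longleftrightarrow> valuation_ring v \<subseteq> valuation_ring w"

definition absolute_value :: "('k::field \<Rightarrow> real) \<Rightarrow> bool" where
  "absolute_value nrm \<longleftrightarrow>
     (\<forall>x. 0 \<le> nrm x) \<and>
     (\<forall>x. nrm x = 0 \<longleftrightarrow> x = 0) \<and>
     (\<forall>x y. nrm (x * y) = nrm x * nrm y) \<and>
     (\<forall>x y. nrm (x + y) \<le> nrm x + nrm y)"

text \<open>The absolute value \<open>|x| = exp (- w x)\<close> attached to a real-valued valuation \<open>w\<close>,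
  with \<open>exp (- \<infinity>) = 0\<close>.\<close>

definition corresponds_to :: "('k::field \<Rightarrow> real) \<Rightarrow> ('k \<Rightarrow> real val_ext) \<Rightarrow> bool" where
  "corresponds_to nrm w \<longleftrightarrow>
     (\<forall>x. nrm x = (case w x of Infty \<Rightarrow> 0 | Val t \<Rightarrow> exp (- t)))"

definition nrm_dist :: "('k::field \<Rightarrow> real) \<Rightarrow> 'k \<Rightarrow> 'k \<Rightarrow> real" where
  "nrm_dist nrm x y = nrm (x - y)"

definition divD :: "'k::field set \<Rightarrow> ('k \<Rightarrow> real) \<Rightarrow> 'k \<Rightarrow> 'k \<Rightarrow> real" where
  "divD R nrm x y = (INF z\<in>R. nrm (y - x * z))"

section \<open>The value set of the valuation ring\<close>

definition value_set ::
  "('k::field \<Rightarrow> 'g::linordered_ab_group_add val_ext) \<Rightarrow> 'g val_ext set" where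
  "value_set v = v ` valuation_ring v"

text \<open>\<open>d(v(x), v(y)) = max (D(x,y), D(y,x))\<close>, computed on chosen representatives;
  independence of the choice is not built in.\<close>

definition value_dist ::
  "('k::field \<Rightarrow> 'g::linordered_ab_group_add val_ext) \<Rightarrow> ('k \<Rightarrow> real) \<Rightarrow>
   'g val_ext \<Rightarrow> 'g val_ext \<Rightarrow> real" where
  "value_dist v nrm a b =
     (let R = valuation_ring v;
          x = (SOME x. x \<in> R \<and> v x = a);
          y = (SOME y. y \<in> R \<and> v y = b)
      in max (divD R nrm x y) (divD R nrm y x))"

text \<open>Two elements of the valuation ring have the same value iff they differ by a unit of it,
  so the value set is the valuation ring modulo multiplication by units.\<close>

lemma value_eq_iff_unit:
  assumes v: "valuation v" and x: "x \<in> valuation_ring v" and y: "y \<in> valuation_ring v"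
  shows "v x = v y \<longleftrightarrow>
    (\<exists>u\<in>valuation_ring v. (\<exists>u'\<in>valuation_ring v. u * u' = 1) \<and> y = x * u)"
proof -
  have inf: "v a = Infty \<longleftrightarrow> a = 0" for a using v by (simp add: valuation_def)
  have mul: "v (a * b) = v a + v b" for a b using v by (simp add: valuation_def)
  have one: "v 1 = Val 0"
    using mul[of 1 1] inf[of 1] by (cases "v 1") (auto simp: plus_val_ext_def)
  have R: "a \<in> valuation_ring v \<longleftrightarrow> a = 0 \<or> (\<exists>g. v a = Val g \<and> 0 \<le> g)" for a
    using inf[of a]
    by (cases "v a") (auto simp: valuation_ring_def less_eq_val_ext_def)
  show ?thesis
  proof
    assume eq: "v x = v y"
    show "\<exists>u\<in>valuation_ring v. (\<exists>u'\<in>valuation_ring v. u * u' = 1) \<and> y = x * u"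
    proof (cases "x = 0")
      case True
      then have "y = 0" using eq inf by metis
      then show ?thesis using True one R[of 1] by (intro bexI[of _ 1]) auto
    next
      case False
      then have y0: "y \<noteq> 0" using eq inf by metis
      have unit: "v (b / a) = Val 0" if "a \<noteq> 0" "b \<noteq> 0" "v a = v b" for a b
        using mul[of a "b / a"] that inf[of a] inf[of "b / a"]
        by (cases "v b"; cases "v (b / a)") (auto simp: plus_val_ext_def)
      have "y / x \<in> valuation_ring v" "x / y \<in> valuation_ring v"
        using unit[of x y] unit[of y x] False y0 eq R by auto
      moreover have "(y / x) * (x / y) = 1" "y = x * (y / x)" using False y0 by auto
      ultimately show ?thesis by blast
    qed
  next
    assume "\<exists>u\<in>valuation_ring v. (\<exists>u'\<in>valuation_ring v. u * u' = 1) \<and> y = x * u"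
    then obtain u u' where u: "u \<in> valuation_ring v" "u' \<in> valuation_ring v"
      "u * u' = 1" "y = x * u" by blast
    then have "u \<noteq> 0" "u' \<noteq> 0" by auto
    then obtain g g' where g: "v u = Val g" "0 \<le> g" "v u' = Val g'" "0 \<le> g'"
      using u R by metis
    have "g + g' = 0" using mul[of u u'] u(3) one g by (simp add: plus_val_ext_def)
    then have "g = 0" using g by (simp add: add_nonneg_eq_0_iff)
    then show "v x = v y" using u(4) mul[of x u] g(1)
      by (cases "v x") (auto simp: plus_val_ext_def)
  qed
qed

section \<open>Metric linear orders\<close>

definition metric_linear_order :: "'a::linorder set \<Rightarrow> ('a \<Rightarrow> 'a \<Rightarrow> real) \<Rightarrow> bool" where
  "metric_linear_order M d \<longleftrightarrow>
     Metric_space M d \<and>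
     (\<forall>a\<in>M. \<forall>e>0. \<forall>x\<in>Metric_space.mball M d a e. \<forall>z\<in>Metric_space.mball M d a e.
        \<forall>y\<in>M. x \<le> y \<and> y \<le> z \<longrightarrow> y \<in> Metric_space.mball M d a e)"

definition ray :: "'a::linorder set \<Rightarrow> ('a \<Rightarrow> 'a \<Rightarrow> real) \<Rightarrow> 'a \<Rightarrow> 'a \<Rightarrow> real" where
  "ray M d a b = (INF c\<in>{c \<in> M. c \<le> b}. d a c)"

definition models_ULO :: "'a::linorder set \<Rightarrow> ('a \<Rightarrow> 'a \<Rightarrow> real) \<Rightarrow> bool" where
  "models_ULO M d \<longleftrightarrow>
     metric_linear_order M d \<and>
     Metric_space.mcomplete M d \<and>
     (\<forall>a\<in>M. \<forall>b\<in>M. d a b \<le> 1) \<and>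
     (\<forall>a\<in>M. \<forall>b\<in>M. \<forall>c\<in>M. d a c \<le> max (d a b) (d b c))"

section \<open>Continuous logic in the language \<open>{0, 1, +, -, \<cdot>, D}\<close>\<close>

datatype mvr_tm =
    TVar nat | TZero | TOne
  | TAdd mvr_tm mvr_tm | TNeg mvr_tm | TMul mvr_tm mvr_tm

text \<open>Truth values lie in \<open>[0,1]\<close>. The connectives are \<open>1\<close>, \<open>p/2\<close> and truncated subtraction,
  which generate a uniformly dense set of all continuous connectives.\<close>

datatype mvr_fm =
    FDist mvr_tm mvr_tm | FD mvr_tm mvr_tm
  | FOne | FHalf mvr_fm | FMonus mvr_fm mvr_fm
  | FSup nat mvr_fm | FInf nat mvr_fm

primrec tm_val :: "(nat \<Rightarrow> 'k::field) \<Rightarrow> mvr_tm \<Rightarrow> 'k" where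
  "tm_val e (TVar i) = e i"
| "tm_val e TZero = 0"
| "tm_val e TOne = 1"
| "tm_val e (TAdd s t) = tm_val e s + tm_val e t"
| "tm_val e (TNeg t) = - tm_val e t"
| "tm_val e (TMul s t) = tm_val e s * tm_val e t"

text \<open>Truth value in the structure \<open>(R, 0, 1, +, -, \<cdot>, D)\<close> with metric \<open>|x - y|\<close>, where \<open>R\<close> is
  a subring of the ambient field.\<close>

primrec fm_val ::
  "'k::field set \<Rightarrow> ('k \<Rightarrow> real) \<Rightarrow> (nat \<Rightarrow> 'k) \<Rightarrow> mvr_fm \<Rightarrow> real" where
  "fm_val R nrm e (FDist s t) = nrm_dist nrm (tm_val e s) (tm_val e t)"
| "fm_val R nrm e (FD s t) = divD R nrm (tm_val e s) (tm_val e t)"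
| "fm_val R nrm e FOne = 1"
| "fm_val R nrm e (FHalf p) = fm_val R nrm e p / 2"
| "fm_val R nrm e (FMonus p q) = max 0 (fm_val R nrm e p - fm_val R nrm e q)"
| "fm_val R nrm e (FSup i p) = (SUP a\<in>R. fm_val R nrm (e(i := a)) p)"
| "fm_val R nrm e (FInf i p) = (INF a\<in>R. fm_val R nrm (e(i := a)) p)"

text \<open>\<open>max p q = 1 - ((1 - p) - (q - p))\<close> with truncated subtractions, for values in \<open>[0,1]\<close>.\<close>

definition FMax :: "mvr_fm \<Rightarrow> mvr_fm \<Rightarrow> mvr_fm" where
  "FMax p q = FMonus FOne (FMonus (FMonus FOne p) (FMonus q p))"

text \<open>The metric linear order \<open>(M, \<le>, d)\<close>, as a metric structure with distinguished predicate
  \<open>ray\<close>, is interpreted without parameters in \<open>(R, 0, 1, +, -, \<cdot>, D)\<close> on the imaginary sort given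
  by the pseudometric \<open>\<rho>\<close> on \<open>n\<close>-tuples: \<open>\<pi>\<close> induces an isometry from the \<open>\<rho>\<close>-quotient of \<open>R\<^sup>n\<close>
  onto a dense subset of \<open>M\<close>, and \<open>\<phi>\<close> defines the pullback of \<open>ray\<close>. Variables \<open>0,\<dots>,n-1\<close> hold
  the first tuple, \<open>n,\<dots>,2n-1\<close> the second; as \<open>e\<close> is an arbitrary assignment, the values
  of \<open>\<rho>\<close> and \<open>\<phi>\<close> depend on no other variable.\<close>

definition interpreted_by ::
  "'k::field set \<Rightarrow> ('k \<Rightarrow> real) \<Rightarrow> nat \<Rightarrow> mvr_fm \<Rightarrow> mvr_fm \<Rightarrow> ('k list \<Rightarrow> 'a::linorder) \<Rightarrow>
   'a set \<Rightarrow> ('a \<Rightarrow> 'a \<Rightarrow> real) \<Rightarrow> bool" where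
  "interpreted_by R nrm n \<rho> \<phi> \<pi> M d \<longleftrightarrow>
     \<pi> ` {xs. length xs = n \<and> set xs \<subseteq> R} \<subseteq> M \<and>
     (Metric_space.mtopology M d) closure_of (\<pi> ` {xs. length xs = n \<and> set xs \<subseteq> R}) = M \<and>
     (\<forall>e. range e \<subseteq> R \<longrightarrow>
        fm_val R nrm e \<rho> = d (\<pi> (map e [0..<n])) (\<pi> (map e [n..<2*n])) \<and>
        fm_val R nrm e \<phi> = ray M d (\<pi> (map e [0..<n])) (\<pi> (map e [n..<2*n])))"

definition value_dist_fm :: mvr_fm where
  "value_dist_fm = FMax (FD (TVar 0) (TVar 1)) (FD (TVar 1) (TVar 0))"

definition value_ray_fm :: mvr_fm where
  "value_ray_fm = FD (TVar 0) (TVar 1)"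

end

theory Submission
  imports Defs
begin

text \<open>For \<open>v x \<le> v y\<close> the element \<open>x\<close> divides \<open>y\<close> in the valuation ring, so \<open>D(x,y) = 0\<close>.
  Otherwise \<open>v (y - x z) = v y\<close> for every \<open>z\<close> in the ring, and since the absolute value comes from a
  coarsening of \<open>v\<close> this gives \<open>|y - x z| = |y|\<close>, so \<open>D(x,y) = |y|\<close>. Hence \<open>|x|\<close> is an antitone
  function \<open>N\<close> of \<open>v x\<close>, and \<open>d(a,b) = N (min a b)\<close> for \<open>a \<noteq> b\<close>. A Cauchy sequence for such a
  distance either has \<open>N\<close> tending to \<open>0\<close>, and then converges to \<open>\<infinity>\<close>, or is eventually constant.\<close>

section \<open>Distances induced by an antitone norm on a linear order\<close>

text \<open>\<open>d_nonneg\<close> and \<open>d_commute\<close> range over the whole type because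
  \<open>Metric_space\<close> demands them outside the carrier too.\<close>

locale antitone_norm_dist =
  fixes M :: "'a::linorder set" and N :: "'a \<Rightarrow> real" and d :: "'a \<Rightarrow> 'a \<Rightarrow> real" and top :: 'a
  assumes d_nonneg: "0 \<le> d a b"
    and d_commute: "d a b = d b a"
    and d_eq: "a \<in> M \<Longrightarrow> b \<in> M \<Longrightarrow> d a b = (if a = b then 0 else N (min a b))"
    and N_antitone: "a \<in> M \<Longrightarrow> b \<in> M \<Longrightarrow> a \<le> b \<Longrightarrow> N b \<le> N a"
    and N_eq_0_iff: "a \<in> M \<Longrightarrow> N a = 0 \<longleftrightarrow> a = top"
    and top_mem: "top \<in> M"
    and le_top: "a \<in> M \<Longrightarrow> a \<le> top"
begin

lemma d_less:
  "a \<in> M \<Longrightarrow> b \<in> M \<Longrightarrow> a < b \<Longrightarrow> d a b = N a"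
  "a \<in> M \<Longrightarrow> b \<in> M \<Longrightarrow> b < a \<Longrightarrow> d a b = N b"
  by (auto simp: d_eq min_def)

lemma d_self: "a \<in> M \<Longrightarrow> d a a = 0"
  by (simp add: d_eq)

lemma d_top: "a \<in> M \<Longrightarrow> d a top = N a"
  using le_top[of a] top_mem N_eq_0_iff[of a] by (auto simp: d_eq min_def)

text \<open>For \<open>a < c\<close> the left side is \<open>N a\<close>. If \<open>a < b\<close>,
  then \<open>d a b = N a\<close>; if \<open>b < a\<close>, then \<open>d a b = N b\<close>, which
  is at least \<open>N a\<close>. Symmetry gives \<open>c < a\<close>.\<close>

lemma d_ultrametric:
  assumes "a \<in> M" "b \<in> M" "c \<in> M"
  shows "d a c \<le> max (d a b) (d b c)"
proof -
  have "d a c \<le> max (d a b) (d b c)" if "a \<in> M" "c \<in> M" "a < c" for a c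
    using that assms(2) d_less[of a c] d_less[of a b] N_antitone[of b a]
    by (cases a b rule: linorder_cases) (auto simp: le_max_iff_disj)
  from this[of a c] this[of c a] show ?thesis
    using assms d_self d_nonneg d_commute[of a b] d_commute[of b c] d_commute[of a c]
    by (cases a c rule: linorder_cases) (auto simp: max.commute le_max_iff_disj)
qed

text \<open>Distinct points at distance 0 would have minimum \<open>top\<close>, so both would equal
  \<open>top\<close>.\<close>

lemma metric_space: "Metric_space M d"
proof
  show "d x y = 0 \<longleftrightarrow> x = y" if "x \<in> M" "y \<in> M" for x y
    using that N_eq_0_iff le_top top_mem
    by (auto simp: d_eq min_def dest!: le_top intro: antisym split: if_splits)
  show "d x z \<le> d x y + d y z" if "x \<in> M" "y \<in> M" "z \<in> M" for x y z
    using d_ultrametric[OF that] d_nonneg[of x y] d_nonneg[of y z] by linarith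
qed (rule d_nonneg d_commute)+

sublocale Metric_space M d
  by (rule metric_space)

text \<open>Above \<open>a\<close> the distance from \<open>a\<close> is constantly
  \<open>N a\<close>, so \<open>z\<close> controls \<open>y\<close>; below \<open>a\<close> it is
  \<open>N y \<le> N x\<close>, so \<open>x\<close> controls \<open>y\<close>.\<close>

lemma mball_convex:
  assumes "a \<in> M" "x \<in> mball a e" "z \<in> mball a e" "y \<in> M" "x \<le> y" "y \<le> z"
  shows "y \<in> mball a e"
proof -
  have xz: "x \<in> M" "z \<in> M" "d a x < e" "d a z < e"
    using assms by auto
  have "d a y < e"
  proof (cases a y rule: linorder_cases)
    case less
    then show ?thesis using assms xz d_less(1)[of a y] d_less(1)[of a z] by auto
  next
    case equal
    then show ?thesis using assms d_self[of y] le_less_trans[OF d_nonneg xz(3)] by simp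
  next
    case greater
    then show ?thesis
      using assms xz d_less(2)[of a y] d_less(2)[of a x] N_antitone[of x y] by auto
  qed
  then show ?thesis using assms by auto
qed

lemma metric_linear_order: "metric_linear_order M d"
  unfolding metric_linear_order_def using metric_space mball_convex by blast

text \<open>The infimum is attained, at \<open>c = a\<close> if \<open>a \<le> b\<close> and at
  \<open>c = b\<close> otherwise.\<close>

lemma ray_eq:
  assumes "a \<in> M" "b \<in> M"
  shows "ray M d a b = (if a \<le> b then 0 else N b)"
  unfolding ray_def
proof (cases "a \<le> b")
  case True
  have "(INF c\<in>{c \<in> M. c \<le> b}. d a c) = 0"
    by (rule cInf_eq_minimum) (use assms True d_self d_nonneg in \<open>auto simp: image_iff\<close>)
  then show "(INF c\<in>{c \<in> M. c \<le> b}. d a c) = (if a \<le> b then 0 else N b)"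
    using True by simp
next
  case False
  then have "b < a" by simp
  then have "d a b = N b" "\<And>c. c \<in> M \<Longrightarrow> c \<le> b \<Longrightarrow> N b \<le> d a c"
    using assms d_less N_antitone by (auto simp: le_less_trans)
  then have "(INF c\<in>{c \<in> M. c \<le> b}. d a c) = N b"
    by (intro cInf_eq_minimum) (use assms in \<open>auto simp: image_iff\<close>)
  then show "(INF c\<in>{c \<in> M. c \<le> b}. d a c) = (if a \<le> b then 0 else N b)"
    using False by simp
qed

lemma mcomplete: "mcomplete"
  unfolding mcomplete_def
proof (intro allI impI)
  fix \<sigma> assume \<sigma>: "MCauchy \<sigma>"
  then have M: "\<sigma> n \<in> M" for n by (auto simp: MCauchy_def)
  show "\<exists>x. limitin mtopology \<sigma> x sequentially"
  proof (cases "\<forall>e>0. \<forall>\<^sub>F n in sequentially. N (\<sigma> n) < e")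
    case True
    then have "limitin mtopology \<sigma> top sequentially"
      using M top_mem by (simp add: limitin_metric d_top)
    then show ?thesis ..
  next
    case False
    then obtain e where e: "e > 0" "\<And>k. \<exists>n\<ge>k. e \<le> N (\<sigma> n)"
      by (auto simp: eventually_sequentially not_less)
    obtain k where k: "\<And>m n. k \<le> m \<Longrightarrow> k \<le> n \<Longrightarrow> d (\<sigma> m) (\<sigma> n) < e"
      using \<sigma> e(1) unfolding MCauchy_def by meson
    obtain m where m: "k \<le> m" "e \<le> N (\<sigma> m)" using e(2) by blast
    \<comment> \<open>If the two terms differed, their distance would be \<open>N\<close> of the
      smaller one, hence at least \<open>N (\<sigma> m) \<ge> e\<close>, against the choice of
      \<open>k\<close>.\<close>
    have const: "\<sigma> n = \<sigma> m" if n: "k \<le> n" for n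
      using k[OF m(1) n] m(2) M[of m] M[of n] d_less[of "\<sigma> m" "\<sigma> n"]
        N_antitone[of "\<sigma> n" "\<sigma> m"]
      by (cases "\<sigma> n" "\<sigma> m" rule: linorder_cases) (auto dest: less_imp_le)
    have "limitin mtopology \<sigma> (\<sigma> m) sequentially"
      unfolding limitin_metric eventually_sequentially
      using M const d_self by (metis (no_types, lifting))
    then show ?thesis ..
  qed
qed

lemma models_ULO:
  assumes "\<And>a. a \<in> M \<Longrightarrow> N a \<le> 1"
  shows "models_ULO M d"
  unfolding models_ULO_def
  using metric_linear_order mcomplete d_ultrametric assms by (auto simp: d_eq min_def)

end

section \<open>The divisibility predicate of a valuation ring\<close>

text \<open>For values in [0,1] only the difference q - p can be truncated; the inner term is then 1
  - max p q.\<close>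

lemma fm_val_FMax:
  assumes "fm_val R nrm e p \<in> {0..1}" "fm_val R nrm e q \<in> {0..1}"
  shows "fm_val R nrm e (FMax p q) = max (fm_val R nrm e p) (fm_val R nrm e q)"
  using assms by (auto simp: FMax_def max_def)

text \<open>\<open>nrm_le_1\<close> is what the coarsening contributes; with multiplicativity it
  makes \<open>nrm\<close> antitone in \<open>v\<close>.\<close>

locale valued_normed_field =
  fixes v :: "'k::field \<Rightarrow> 'g::linordered_ab_group_add val_ext" and nrm :: "'k \<Rightarrow> real"
  assumes val: "valuation v"
    and abs_val: "absolute_value nrm"
    and nrm_le_1: "x \<in> valuation_ring v \<Longrightarrow> nrm x \<le> 1"
begin

lemma v_eq_Infty_iff: "v x = Infty \<longleftrightarrow> x = 0"
  and v_mult: "v (x * y) = v x + v y"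
  and v_add: "min (v x) (v y) \<le> v (x + y)"
  using val by (auto simp: valuation_def)

lemma nrm_nonneg: "0 \<le> nrm x"
  and nrm_eq_0_iff: "nrm x = 0 \<longleftrightarrow> x = 0"
  and nrm_mult: "nrm (x * y) = nrm x * nrm y"
  using abs_val by (auto simp: absolute_value_def)

lemma v_0: "v 0 = Infty"
  by (simp add: v_eq_Infty_iff)

lemma zero_mem: "0 \<in> valuation_ring v"
  by (simp add: valuation_ring_def v_0 less_eq_val_ext_def)

lemma v_1: "v 1 = Val 0"
  using v_mult[of 1 1] v_eq_Infty_iff[of 1] by (cases "v 1") (auto simp: plus_val_ext_def)

lemma v_minus: "v (- x) = v x"
proof -
  \<comment> \<open>The square of -1 is 1, so its value g satisfies g + g = 0, which forces g = 0 in
    an ordered group.\<close>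
  have "v (- 1) = Val 0"
    using v_mult[of "- 1" "- 1"] v_1 v_eq_Infty_iff[of "- 1"]
    by (cases "v (- 1)") (auto simp: plus_val_ext_def double_zero_sym)
  then show ?thesis
    using v_mult[of "- 1" x] by (cases "v x") (auto simp: plus_val_ext_def)
qed

lemma v_le_imp_dvd:
  assumes "v x \<le> v y"
  obtains z where "z \<in> valuation_ring v" "y = x * z"
proof (cases "x = 0")
  case True
  then have "v y = Infty"
    using assms v_0 by (cases "v y") (auto simp: less_eq_val_ext_def)
  then show ?thesis using that[OF zero_mem] True v_eq_Infty_iff by simp
next
  case False
  then have eq: "y = x * (y / x)" by simp
  then have "v y = v x + v (y / x)" using v_mult by metis
  then have "y / x \<in> valuation_ring v"
    using assms False v_eq_Infty_iff[of x]
    by (cases "v x"; cases "v (y / x)")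
      (auto simp: valuation_ring_def less_eq_val_ext_def plus_val_ext_def)
  then show ?thesis using that eq by blast
qed

lemma v_le_v_mult: "z \<in> valuation_ring v \<Longrightarrow> v x \<le> v (x * z)"
  by (cases "v x"; cases "v z")
    (auto simp: v_mult valuation_ring_def less_eq_val_ext_def plus_val_ext_def)

lemma nrm_antitone:
  assumes "v x \<le> v y"
  shows "nrm y \<le> nrm x"
proof -
  obtain z where "z \<in> valuation_ring v" "y = x * z"
    using assms by (rule v_le_imp_dvd)
  then show ?thesis
    using nrm_le_1 nrm_nonneg by (simp add: nrm_mult mult_left_le)
qed

lemma nrm_cong: "v x = v y \<Longrightarrow> nrm x = nrm y"
  by (simp add: nrm_antitone order.antisym)

text \<open>Since \<open>nrm\<close> factors through \<open>v\<close>, the arbitrary preimage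
  \<open>inv v\<close> turns it into a function of values.\<close>

lemma nrm_inv: "nrm (inv v (v x)) = nrm x"
  by (rule nrm_cong) (simp add: f_inv_into_f)

lemma v_diff_eq:
  assumes "v y < v x"
  shows "v (y - x) = v y"
proof (rule order.antisym)
  show "v y \<le> v (y - x)"
    using v_add[of y "- x"] assms by (simp add: v_minus min_def split: if_splits)
  \<comment> \<open>Otherwise both summands of y = (y - x) + x would have value above
    \<open>v y\<close>.\<close>
  show "v (y - x) \<le> v y"
    using v_add[of "y - x" x] assms by (auto simp: min_def split: if_splits)
qed

lemma divD_eq: "divD (valuation_ring v) nrm x y = (if v x \<le> v y then 0 else nrm y)"
proof (cases "v x \<le> v y")
  case True
  then obtain z where "z \<in> valuation_ring v" "y = x * z" by (rule v_le_imp_dvd)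
  then have "(INF z\<in>valuation_ring v. nrm (y - x * z)) = 0"
    using nrm_nonneg nrm_eq_0_iff by (intro cInf_eq_minimum) (auto simp: image_iff)
  then show ?thesis using True by (simp add: divD_def)
next
  case False
  \<comment> \<open>Multiplying by \<open>z\<close> cannot lower the value, so
    \<open>v y < v x \<le> v (x * z)\<close>.\<close>
  have "nrm (y - x * z) = nrm y" if "z \<in> valuation_ring v" for z
    using False v_le_v_mult[OF that, of x] by (intro nrm_cong v_diff_eq) auto
  then have "(INF z\<in>valuation_ring v. nrm (y - x * z)) = (INF z\<in>valuation_ring v. nrm y)"
    by (intro INF_cong) auto
  also have "\<dots> = nrm y" using zero_mem by (intro cINF_const) auto
  finally show ?thesis using False by (simp add: divD_def)
qed

section \<open>The value set: distance, ray predicate and interpretation\<close>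

lemma divD_cong:
  assumes "v x = v x'" "v y = v y'"
  shows "divD (valuation_ring v) nrm x y = divD (valuation_ring v) nrm x' y'"
  using assms nrm_cong[of y y'] by (simp add: divD_eq)

lemma divD_bounds:
  assumes "y \<in> valuation_ring v"
  shows "0 \<le> divD (valuation_ring v) nrm x y" "divD (valuation_ring v) nrm x y \<le> 1"
  using assms nrm_le_1 nrm_nonneg by (auto simp: divD_eq)

text \<open>By \<open>divD_cong\<close> the predicate depends on values only, so the chosen
  representatives may be replaced by \<open>x\<close> and \<open>y\<close>.\<close>

lemma value_dist_eq:
  assumes "x \<in> valuation_ring v" "y \<in> valuation_ring v"
  shows "value_dist v nrm (v x) (v y) =
    max (divD (valuation_ring v) nrm x y) (divD (valuation_ring v) nrm y x)"
proof -
  have rep: "v (SOME x'. x' \<in> valuation_ring v \<and> v x' = v x) = v x"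
    if "x \<in> valuation_ring v" for x
    using someI[of "\<lambda>x'. x' \<in> valuation_ring v \<and> v x' = v x" x] that by blast
  show ?thesis
    unfolding value_dist_def Let_def
    using rep[OF assms(1)] rep[OF assms(2)] by (intro arg_cong2[where f = max] divD_cong)
qed

lemma antitone_norm_dist_value_set:
  "antitone_norm_dist (value_set v) (\<lambda>a. nrm (inv v a)) (value_dist v nrm) Infty"
proof
  fix a b
  show "0 \<le> value_dist v nrm a b"
    by (simp add: value_dist_def Let_def divD_eq nrm_nonneg le_max_iff_disj)
  show "value_dist v nrm a b = value_dist v nrm b a"
    by (simp add: value_dist_def Let_def max.commute)
  show "Infty \<in> value_set v"
    using zero_mem v_0 by (force simp: value_set_def)
  show "a \<le> Infty" by (simp add: less_eq_val_ext_def)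
  assume "a \<in> value_set v"
  then obtain x where x: "x \<in> valuation_ring v" "a = v x" by (auto simp: value_set_def)
  show "nrm (inv v a) = 0 \<longleftrightarrow> a = Infty"
    using x by (simp add: nrm_inv nrm_eq_0_iff v_eq_Infty_iff)
  assume "b \<in> value_set v"
  then obtain y where y: "y \<in> valuation_ring v" "b = v y" by (auto simp: value_set_def)
  \<comment> \<open>One of the two predicates vanishes; the other, if \<open>a\<close> and
    \<open>b\<close> differ, is the norm of the element of smaller value.\<close>
  show "value_dist v nrm a b = (if a = b then 0 else nrm (inv v (min a b)))"
    using x y by (auto simp: value_dist_eq divD_eq nrm_inv nrm_nonneg min_def)
  show "nrm (inv v b) \<le> nrm (inv v a)" if "a \<le> b"
    using that x y by (simp add: nrm_inv nrm_antitone)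
qed

sublocale value_set: antitone_norm_dist "value_set v" "\<lambda>a. nrm (inv v a)" "value_dist v nrm" Infty
  by (rule antitone_norm_dist_value_set)

lemma ray_value_set:
  assumes "x \<in> valuation_ring v" "y \<in> valuation_ring v"
  shows "ray (value_set v) (value_dist v nrm) (v x) (v y) = divD (valuation_ring v) nrm x y"
proof -
  have "v x \<in> value_set v" "v y \<in> value_set v" using assms by (auto simp: value_set_def)
  then show ?thesis by (simp add: value_set.ray_eq divD_eq nrm_inv)
qed

lemma interpreted_value_set:
  "interpreted_by (valuation_ring v) nrm 1 value_dist_fm value_ray_fm (\<lambda>xs. v (hd xs))
     (value_set v) (value_dist v nrm)"
proof -
  have img: "(\<lambda>xs. v (hd xs)) ` {xs. length xs = 1 \<and> set xs \<subseteq> valuation_ring v} = value_set v"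
    by (force simp: value_set_def length_Suc_conv image_iff)
  \<comment> \<open>The coordinate map is already onto, so density reduces to the closure of the
    whole space.\<close>
  have clo: "value_set.mtopology closure_of value_set v = value_set v"
    using closure_of_topspace[of value_set.mtopology] by simp
  have "fm_val (valuation_ring v) nrm e value_dist_fm = value_dist v nrm (v (e 0)) (v (e 1))"
    and "fm_val (valuation_ring v) nrm e value_ray_fm =
      ray (value_set v) (value_dist v nrm) (v (e 0)) (v (e 1))"
    if "range e \<subseteq> valuation_ring v" for e
  proof -
    have e: "e i \<in> valuation_ring v" for i using that by auto
    show "fm_val (valuation_ring v) nrm e value_dist_fm = value_dist v nrm (v (e 0)) (v (e 1))"
      unfolding value_dist_fm_def using e divD_bounds
      by (subst fm_val_FMax) (auto simp: value_dist_eq)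
    show "fm_val (valuation_ring v) nrm e value_ray_fm =
      ray (value_set v) (value_dist v nrm) (v (e 0)) (v (e 1))"
      using e by (simp add: value_ray_fm_def ray_value_set)
  qed
  then show ?thesis
    unfolding interpreted_by_def img by (simp add: clo upt_rec)
qed

lemma models_ULO_value_set: "models_ULO (value_set v) (value_dist v nrm)"
proof (rule value_set.models_ULO)
  fix a assume "a \<in> value_set v"
  then obtain x where x: "x \<in> valuation_ring v" "a = v x" by (auto simp: value_set_def)
  then show "nrm (inv v a) \<le> 1" using nrm_le_1 by (simp add: nrm_inv)
qed

end

theorem theorem9p8:
  fixes v :: "'k::field \<Rightarrow> 'g::linordered_ab_group_add val_ext"
    and w :: "'k \<Rightarrow> real val_ext"
    and nrm :: "'k \<Rightarrow> real"
  assumes "valuation v"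
    and "absolute_value nrm"
    and "valuation w" and "corresponds_to nrm w" and "coarsens w v"
    and "Metric_space.mcomplete (valuation_ring v) (nrm_dist nrm)"
  shows "(\<forall>x\<in>valuation_ring v. \<forall>y\<in>valuation_ring v.
           value_dist v nrm (v x) (v y) =
             max (divD (valuation_ring v) nrm x y) (divD (valuation_ring v) nrm y x)) \<and>
         metric_linear_order (value_set v) (value_dist v nrm) \<and>
         (\<forall>x\<in>valuation_ring v. \<forall>y\<in>valuation_ring v.
           ray (value_set v) (value_dist v nrm) (v x) (v y) = divD (valuation_ring v) nrm x y) \<and>
         interpreted_by (valuation_ring v) nrm 1 value_dist_fm value_ray_fm (\<lambda>xs. v (hd xs))
           (value_set v) (value_dist v nrm) \<and>
         models_ULO (value_set v) (value_dist v nrm)"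
proof -
  have "nrm x \<le> 1" if "x \<in> valuation_ring v" for x
  proof -
    \<comment> \<open>A nonnegative real value t gives exp (- t) \<le> 1, and \<open>Infty\<close>
      gives 0.\<close>
    have "Val 0 \<le> w x"
      using \<open>coarsens w v\<close> that by (auto simp: coarsens_def valuation_ring_def)
    then show ?thesis
      using \<open>corresponds_to nrm w\<close>
      by (cases "w x") (auto simp: corresponds_to_def less_eq_val_ext_def)
  qed
  then interpret valued_normed_field v nrm
    using assms by unfold_locales
  show ?thesis
    using value_dist_eq value_set.metric_linear_order ray_value_set interpreted_value_set
      models_ULO_value_set by blast
qed

end
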